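(* Let $\mathcal{X}$ be a set and let $k : \mathcal{X}\times\mathcal{X}\to(0,\infty)$ be a positive definite kernel such that the kernel $\frac{k}{1+k} : (x,y)\mapsto \frac{k(x,y)}{1+k(x,y)}$ is also positive definite on $\mathcal{X}$. Then the kernel $K$ defined on $\mathcal{X}^\star=\bigcup_{i=1}^\infty \mathcal{X}^i$ by $$K(\mathbf{x},\mathbf{y}) = \sum_{\pi\in\mathcal{A}(\mathbf{x},\mathbf{y})}\ \prod_{i=1}^{|\pi|} k\bigl(x_{\pi_1(i)},\,y_{\pi_2(i)}\bigr),\qquad \mathbf{x},\mathbf{y}\in\mathcal{X}^\star,$$ where $\mathcal{A}(\mathbf{x},\mathbf{y})$ is the set of all alignments between $\mathbf{x}$ and $\mathbf{y}$, is positive definite on $\mathcal{X}^\star$.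
   Context: $\mathbb{N}=\{1,2,\ldots\}$. $\mathcal{X}^\star=\bigcup_{i=1}^\infty\mathcal{X}^i$ is the set of all nonempty finite sequences with values in $\mathcal{X}$. Positive definite kernel: a symmetric function $\kappa:E\times E\to\mathbb{R}$ on a set $E$ such that for every $N\in\mathbb{N}$, all $e_1,\ldots,e_N\in E$ and all $c_1,\ldots,c_N\in\mathbb{R}$, one has $\sum_{i,j=1}^N c_ic_j\,\kappa(e_i,e_j)\ge 0$. Alignment: let $\mathbf{x}=(x_1,\ldots,x_n)$ and $\mathbf{y}=(y_1,\ldots,y_m)$ be elements of $\mathcal{X}^\star$. An alignment $\pi$ of length $|\pi|=p$ between $\mathbf{x}$ and $\mathbf{y}$ is a pair $(\pi_1,\pi_2)$ of $p$-tuples of positive integers such that $$1=\pi_1(1)\le\cdots\le\pi_1(p)=n,\qquad 1=\pi_2(1)\le\cdots\le\pi_2(p)=m,$$ and for all $1\le i\le p-1$, $$\pi_1(i+1)\le\pi_1(i)+1,\qquad \pi_2(i+1)\le\pi_2(i)+1,\qquad (\pi_1(i+1)-\pi_1(i))+(\pi_2(i+1)-\pi_2(i))\ge 1.$$ $\mathcal{A}(\mathbf{x},\mathbf{y})$ denotes the (finite) set of all alignments, of all possible lengths $p$, between $\mathbf{x}$ and $\mathbf{y}$. *)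

theory Defs
  imports Complex_Main
begin

definition pos_def_kernel_on :: "'e set \<Rightarrow> ('e \<Rightarrow> 'e \<Rightarrow> real) \<Rightarrow> bool" where
  "pos_def_kernel_on E \<kappa> \<longleftrightarrow>
     (\<forall>x\<in>E. \<forall>y\<in>E. \<kappa> x y = \<kappa> y x) \<and>
     (\<forall>(N::nat) (e :: nat \<Rightarrow> 'e) (c :: nat \<Rightarrow> real).
        N \<ge> 1 \<longrightarrow> (\<forall>i\<in>{1..N}. e i \<in> E) \<longrightarrow>
        (\<Sum>i=1..N. \<Sum>j=1..N. c i * c j * \<kappa> (e i) (e j)) \<ge> 0)"

definition nonempty_seqs :: "'a set \<Rightarrow> 'a list set" where
  "nonempty_seqs X = {xs. xs \<noteq> [] \<and> set xs \<subseteq> X}"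

text \<open>
  A tuple of length \<open>p\<close> is a list, so the mathematical \<open>\<pi>\<^sub>1(i)\<close> is \<open>\<pi>1 ! (i - 1)\<close>. The entries
  of \<open>\<pi>1\<close> and \<open>\<pi>2\<close> are themselves one-based positions in the two sequences. The increments are
  taken in the integers to avoid truncated subtraction.
\<close>

definition is_alignment :: "'a list \<Rightarrow> 'a list \<Rightarrow> nat list \<times> nat list \<Rightarrow> bool" where
  "is_alignment x y = (\<lambda>(\<pi>1, \<pi>2).
     length \<pi>1 = length \<pi>2 \<and> \<pi>1 \<noteq> [] \<and>
     set \<pi>1 \<subseteq> {1..} \<and> set \<pi>2 \<subseteq> {1..} \<and>
     hd \<pi>1 = 1 \<and> sorted \<pi>1 \<and> last \<pi>1 = length x \<and>
     hd \<pi>2 = 1 \<and> sorted \<pi>2 \<and> last \<pi>2 = length y \<and>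
     (\<forall>i. Suc i < length \<pi>1 \<longrightarrow>
        \<pi>1 ! Suc i \<le> \<pi>1 ! i + 1 \<and>
        \<pi>2 ! Suc i \<le> \<pi>2 ! i + 1 \<and>
        (int (\<pi>1 ! Suc i) - int (\<pi>1 ! i)) + (int (\<pi>2 ! Suc i) - int (\<pi>2 ! i)) \<ge> 1))"

definition alignments :: "'a list \<Rightarrow> 'a list \<Rightarrow> (nat list \<times> nat list) set" where
  "alignments x y = {\<pi>. is_alignment x y \<pi>}"

definition alignment_kernel :: "('a \<Rightarrow> 'a \<Rightarrow> real) \<Rightarrow> 'a list \<Rightarrow> 'a list \<Rightarrow> real" where
  "alignment_kernel k x y =
     (\<Sum>(\<pi>1, \<pi>2)\<in>alignments x y. \<Prod>i<length \<pi>1. k (x ! (\<pi>1 ! i - 1)) (y ! (\<pi>2 ! i - 1)))"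

text \<open>The sum above is not the default value for infinite index sets:\<close>

lemma finite_alignments: "finite (alignments x y)"
proof -
  let ?B = "\<lambda>z. {p :: nat list. set p \<subseteq> {..length z} \<and> length p \<le> length x + length y}"
  have "alignments x y \<subseteq> ?B x \<times> ?B y"
  proof
    fix \<pi> assume "\<pi> \<in> alignments x y"
    then obtain p q where \<pi>: "\<pi> = (p, q)" and al: "is_alignment x y (p, q)"
      unfolding alignments_def by (cases \<pi>) auto
    have len: "length p = length q" "p \<noteq> []" "q \<noteq> []"
      and srt: "sorted p" "sorted q" and lst: "last p = length x" "last q = length y"
      and pos: "set p \<subseteq> {1..}" "set q \<subseteq> {1..}"
      and step: "\<And>i. Suc i < length p \<Longrightarrow> p ! i + q ! i < p ! Suc i + q ! Suc i"
      using al unfolding is_alignment_def by force+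
    have le_last: "a \<le> last r" if "sorted r" "a \<in> set r" for r :: "nat list" and a
      using that by (cases r rule: rev_cases) (auto simp: sorted_append)
    have grow: "i < length p \<Longrightarrow> i + 1 \<le> p ! i + q ! i" for i
    proof (induction i)
      case 0
      then have "p ! 0 \<in> set p" by simp
      with pos have "1 \<le> p ! 0" by auto
      then show ?case by simp
    next
      case (Suc i)
      then show ?case using step[of i] by simp
    qed
    have "length p \<le> p ! (length p - 1) + q ! (length p - 1)"
    proof -
      have "0 < length p" using len by simp
      then show ?thesis using grow[of "length p - 1"] by linarith
    qed
    also have "\<dots> = length x + length y"
      using lst len by (simp add: last_conv_nth)
    finally show "\<pi> \<in> ?B x \<times> ?B y"
      using le_last srt lst len \<pi> by force
  qed
  moreover have "finite (?B x \<times> ?B y)"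
    by (intro finite_cartesian_product finite_lists_length_le) auto
  ultimately show ?thesis by (rule finite_subset)
qed

end

theory Submission
  imports Defs
begin

text \<open>Put \<open>\<kappa> = k / (1 + k)\<close>, so that \<open>k\<close> is the sum of \<open>\<kappa>^r\<close> over \<open>r \<ge> 1\<close>. Expanding every factor
  \<open>k\<close> of an alignment amounts to letting both indices stay in place, so \<open>K\<close> becomes a sum of
  products of \<open>\<kappa>\<close> over pairs of stretchings of the two sequences to a common length; for a bounded
  length this is a sum of compositions of powers of \<open>\<kappa>\<close>, hence positive definite. Writing \<open>x'\<close> for \<open>x\<close>
  without its last entry, the same is seen recursively: \<open>K\<close> solves
  \<open>K(x,y) = \<kappa>(last x, last y) (K(x,y) + K(x',y) + K(x,y') + K(x',y'))\<close>, and iterating the right-hand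
  side yields positive definite kernels, by the Schur product theorem, that increase to \<open>K\<close>.\<close>

section \<open>Closure properties of positive definite kernels\<close>

lemma pos_def_kernel_onI:
  assumes "\<And>x y. x \<in> E \<Longrightarrow> y \<in> E \<Longrightarrow> \<kappa> x y = \<kappa> y x"
    and "\<And>(I :: nat set) e c. finite I \<Longrightarrow> e ` I \<subseteq> E \<Longrightarrow>
           (\<Sum>i\<in>I. \<Sum>j\<in>I. c i * c j * \<kappa> (e i) (e j)) \<ge> 0"
  shows "pos_def_kernel_on E \<kappa>"
  unfolding pos_def_kernel_on_def by (intro conjI allI impI ballI assms) auto

lemma pos_def_kernel_on_sym:
  "pos_def_kernel_on E \<kappa> \<Longrightarrow> x \<in> E \<Longrightarrow> y \<in> E \<Longrightarrow> \<kappa> x y = \<kappa> y x"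
  unfolding pos_def_kernel_on_def by blast

text \<open>Renumbering by a bijection from \<open>{1..card I}\<close> frees the index type, so that
  quadratic forms may run over subsets or over pairs of indices. The empty set is separate because
  the definition asks for \<open>N \<ge> 1\<close>.\<close>

lemma pos_def_kernel_on_sum_nonneg:
  fixes c :: "'i \<Rightarrow> real"
  assumes pd: "pos_def_kernel_on E \<kappa>" and fin: "finite I" and e: "e ` I \<subseteq> E"
  shows "(\<Sum>i\<in>I. \<Sum>j\<in>I. c i * c j * \<kappa> (e i) (e j)) \<ge> 0"
proof (cases "I = {}")
  case False
  obtain h where h: "bij_betw h {1..card I} I"
    using ex_bij_betw_nat_finite_1[OF fin] by blast
  have eq: "(\<Sum>i\<in>I. f i) = (\<Sum>i=1..card I. f (h i))" for f :: "'i \<Rightarrow> real"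
    using sum.reindex_bij_betw[OF h, of f] by simp
  have "card I \<ge> 1" using False fin by (simp add: Suc_leI card_gt_0_iff)
  moreover have "\<forall>i\<in>{1..card I}. (e \<circ> h) i \<in> E"
    using e bij_betwE[OF h] by auto
  ultimately have "(\<Sum>i=1..card I. \<Sum>j=1..card I.
      (c \<circ> h) i * (c \<circ> h) j * \<kappa> ((e \<circ> h) i) ((e \<circ> h) j)) \<ge> 0"
    using pd unfolding pos_def_kernel_on_def by blast
  then show ?thesis by (simp add: eq)
qed simp

lemma pos_def_kernel_on_subset:
  assumes "pos_def_kernel_on E \<kappa>" "F \<subseteq> E"
  shows "pos_def_kernel_on F \<kappa>"
proof (rule pos_def_kernel_onI)
  show "\<kappa> x y = \<kappa> y x" if "x \<in> F" "y \<in> F" for x y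
    using that assms(2) by (intro pos_def_kernel_on_sym[OF assms(1)]) auto
  show "(\<Sum>i\<in>I. \<Sum>j\<in>I. c i * c j * \<kappa> (e i) (e j)) \<ge> 0"
    if "finite I" "e ` I \<subseteq> F" for I :: "nat set" and e c
    using that assms(2) by (intro pos_def_kernel_on_sum_nonneg[OF assms(1)]) auto
qed

lemma pos_def_kernel_on_cong:
  assumes "pos_def_kernel_on E \<kappa>" "\<And>x y. x \<in> E \<Longrightarrow> y \<in> E \<Longrightarrow> \<kappa> x y = \<kappa>' x y"
  shows "pos_def_kernel_on E \<kappa>'"
proof (rule pos_def_kernel_onI)
  show "\<kappa>' x y = \<kappa>' y x" if "x \<in> E" "y \<in> E" for x y
    using that assms(2)[of x y] assms(2)[of y x] pos_def_kernel_on_sym[OF assms(1) that] by simp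
  fix I :: "nat set" and e c assume I: "finite I" "e ` I \<subseteq> E"
  then have "(\<Sum>i\<in>I. \<Sum>j\<in>I. c i * c j * \<kappa>' (e i) (e j)) = (\<Sum>i\<in>I. \<Sum>j\<in>I. c i * c j * \<kappa> (e i) (e j))"
    by (intro sum.cong refl) (auto simp: assms(2) image_subset_iff)
  then show "(\<Sum>i\<in>I. \<Sum>j\<in>I. c i * c j * \<kappa>' (e i) (e j)) \<ge> 0"
    using pos_def_kernel_on_sum_nonneg[OF assms(1) I, of c] by simp
qed

lemma pos_def_kernel_on_comp:
  assumes "pos_def_kernel_on E \<kappa>" "f ` F \<subseteq> E"
  shows "pos_def_kernel_on F (\<lambda>x y. \<kappa> (f x) (f y))"
proof (rule pos_def_kernel_onI)
  fix I :: "nat set" and e c assume "finite I" "e ` I \<subseteq> F"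
  with assms show "(\<Sum>i\<in>I. \<Sum>j\<in>I. c i * c j * \<kappa> (f (e i)) (f (e j))) \<ge> 0"
    by (intro pos_def_kernel_on_sum_nonneg[where e = "\<lambda>i. f (e i)"]) auto
qed (use assms in \<open>auto intro!: pos_def_kernel_on_sym[OF assms(1)]\<close>)

lemma pos_def_kernel_on_rank_one: "pos_def_kernel_on E (\<lambda>x y. f x * f y)"
proof (rule pos_def_kernel_onI)
  fix I :: "nat set" and e c
  have "(\<Sum>i\<in>I. \<Sum>j\<in>I. c i * c j * (f (e i) * f (e j))) = (\<Sum>i\<in>I. c i * f (e i))\<^sup>2"
    by (simp add: power2_eq_square sum_product algebra_simps)
  then show "(\<Sum>i\<in>I. \<Sum>j\<in>I. c i * c j * (f (e i) * f (e j))) \<ge> 0" by simp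
qed simp

lemma pos_def_kernel_on_add:
  assumes "pos_def_kernel_on E \<kappa>" "pos_def_kernel_on E \<kappa>'"
  shows "pos_def_kernel_on E (\<lambda>x y. \<kappa> x y + \<kappa>' x y)"
proof (rule pos_def_kernel_onI)
  fix I :: "nat set" and e c assume "finite I" "e ` I \<subseteq> E"
  then show "(\<Sum>i\<in>I. \<Sum>j\<in>I. c i * c j * (\<kappa> (e i) (e j) + \<kappa>' (e i) (e j))) \<ge> 0"
    using pos_def_kernel_on_sum_nonneg[OF assms(1), of I e c]
      pos_def_kernel_on_sum_nonneg[OF assms(2), of I e c]
    by (simp add: distrib_left sum.distrib)
qed (simp add: pos_def_kernel_on_sym[OF assms(1)] pos_def_kernel_on_sym[OF assms(2)])

text \<open>Indices whose points lie outside \<open>F\<close> contribute nothing to the quadratic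
  form. Used for the part of the recursion that vanishes as soon as one list is empty.\<close>

lemma pos_def_kernel_on_extend_zero:
  assumes "pos_def_kernel_on (E \<inter> F) \<kappa>"
  shows "pos_def_kernel_on E (\<lambda>x y. if x \<in> F \<and> y \<in> F then \<kappa> x y else 0)"
proof (rule pos_def_kernel_onI)
  fix I :: "nat set" and e c assume I: "finite I" "e ` I \<subseteq> E"
  let ?J = "{i \<in> I. e i \<in> F}"
  have "(\<Sum>i\<in>I. \<Sum>j\<in>I. c i * c j * (if e i \<in> F \<and> e j \<in> F then \<kappa> (e i) (e j) else 0))
      = (\<Sum>i\<in>I. if e i \<in> F then \<Sum>j\<in>I. if e j \<in> F then c i * c j * \<kappa> (e i) (e j) else 0 else 0)"
    by (intro sum.cong) (auto intro!: sum.cong sum.neutral)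
  also have "\<dots> = (\<Sum>i\<in>?J. \<Sum>j\<in>?J. c i * c j * \<kappa> (e i) (e j))"
    using I by (simp add: sum.inter_filter)
  also have "\<dots> \<ge> 0"
    using I by (intro pos_def_kernel_on_sum_nonneg[OF assms]) auto
  finally show "(\<Sum>i\<in>I. \<Sum>j\<in>I. c i * c j * (if e i \<in> F \<and> e j \<in> F then \<kappa> (e i) (e j) else 0)) \<ge> 0" .
qed (use assms in \<open>auto intro: pos_def_kernel_on_sym\<close>)

text \<open>Give every point \<open>f a (e i)\<close> the coefficient \<open>c i\<close>, whatever
  \<open>a\<close> is: the form of \<open>\<kappa>\<close> indexed by the pairs
  \<open>(i, a)\<close> is then the form of the sum kernel at the points \<open>e i\<close>.\<close>

lemma pos_def_kernel_on_sum_maps: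
  assumes pd: "pos_def_kernel_on E \<kappa>" and fin: "finite A"
    and f: "\<And>a x. a \<in> A \<Longrightarrow> x \<in> F \<Longrightarrow> f a x \<in> E"
  shows "pos_def_kernel_on F (\<lambda>x y. \<Sum>a\<in>A. \<Sum>b\<in>A. \<kappa> (f a x) (f b y))"
proof (rule pos_def_kernel_onI)
  fix I :: "nat set" and e c assume I: "finite I" "e ` I \<subseteq> F"
  have "0 \<le> (\<Sum>u\<in>I\<times>A. \<Sum>v\<in>I\<times>A. c (fst u) * c (fst v) * \<kappa> (f (snd u) (e (fst u))) (f (snd v) (e (fst v))))"
    using I fin f by (intro pos_def_kernel_on_sum_nonneg[OF pd, where e = "\<lambda>u. f (snd u) (e (fst u))"]) auto
  also have "\<dots> = (\<Sum>i\<in>I. \<Sum>a\<in>A. \<Sum>j\<in>I. \<Sum>b\<in>A. c i * c j * \<kappa> (f a (e i)) (f b (e j)))"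
    by (simp add: sum.cartesian_product')
  also have "\<dots> = (\<Sum>i\<in>I. \<Sum>j\<in>I. \<Sum>a\<in>A. \<Sum>b\<in>A. c i * c j * \<kappa> (f a (e i)) (f b (e j)))"
    by (intro sum.cong refl sum.swap)
  finally show "(\<Sum>i\<in>I. \<Sum>j\<in>I. c i * c j * (\<Sum>a\<in>A. \<Sum>b\<in>A. \<kappa> (f a (e i)) (f b (e j)))) \<ge> 0"
    by (simp add: sum_distrib_left)
next
  fix x y assume "x \<in> F" "y \<in> F"
  then have "(\<Sum>a\<in>A. \<Sum>b\<in>A. \<kappa> (f a x) (f b y)) = (\<Sum>a\<in>A. \<Sum>b\<in>A. \<kappa> (f b y) (f a x))"
    using f by (intro sum.cong refl pos_def_kernel_on_sym[OF pd]) auto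
  also have "\<dots> = (\<Sum>a\<in>A. \<Sum>b\<in>A. \<kappa> (f a y) (f b x))"
    by (rule sum.swap)
  finally show "(\<Sum>a\<in>A. \<Sum>b\<in>A. \<kappa> (f a x) (f b y)) = (\<Sum>a\<in>A. \<Sum>b\<in>A. \<kappa> (f a y) (f b x))" .
qed

text \<open>Each quadratic form is a finite sum, so its nonnegativity survives pointwise
  limits.\<close>

lemma pos_def_kernel_on_limit:
  assumes pd: "\<And>n. pos_def_kernel_on E (\<kappa> n)"
    and lim: "\<And>x y. x \<in> E \<Longrightarrow> y \<in> E \<Longrightarrow> (\<lambda>n. \<kappa> n x y) \<longlonglongrightarrow> L x y"
  shows "pos_def_kernel_on E L"
proof (rule pos_def_kernel_onI)
  fix I :: "nat set" and e c assume I: "finite I" "e ` I \<subseteq> E"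
  have "(\<lambda>n. \<Sum>i\<in>I. \<Sum>j\<in>I. c i * c j * \<kappa> n (e i) (e j))
      \<longlonglongrightarrow> (\<Sum>i\<in>I. \<Sum>j\<in>I. c i * c j * L (e i) (e j))"
    using I by (intro tendsto_intros lim) auto
  then show "(\<Sum>i\<in>I. \<Sum>j\<in>I. c i * c j * L (e i) (e j)) \<ge> 0"
    using pos_def_kernel_on_sum_nonneg[OF pd I] by (intro LIMSEQ_le_const) blast+
next
  fix x y assume xy: "x \<in> E" "y \<in> E"
  then have "(\<lambda>n. \<kappa> n y x) = (\<lambda>n. \<kappa> n x y)"
    using pos_def_kernel_on_sym[OF pd] by blast
  then show "L x y = L y x"
    using lim[of x y] lim[of y x] xy LIMSEQ_unique by metis
qed

section \<open>The Schur product theorem\<close>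

text \<open>On the vector with \<open>s\<close> at \<open>i\<close> and \<open>1\<close> at
  \<open>n\<close> the form has no constant term, so a nonzero linear coefficient would make it
  negative for some small \<open>s\<close>. This handles a vanishing pivot in the elimination
  below.\<close>

lemma psd_matrix_zero_diag:
  fixes A :: "'i \<Rightarrow> 'i \<Rightarrow> real"
  assumes psd: "\<And>c. (\<Sum>i\<in>I. \<Sum>j\<in>I. c i * c j * A i j) \<ge> 0"
    and sym: "\<And>i j. i \<in> I \<Longrightarrow> j \<in> I \<Longrightarrow> A i j = A j i"
    and I: "finite I" "n \<in> I" "i \<in> I" and zero: "A n n = 0"
  shows "A i n = 0"
proof (cases "i = n")
  case False
  have quad: "s * s * A i i + 2 * s * A i n \<ge> 0" for s
  proof -
    let ?c = "\<lambda>j. if j = i then s else if j = n then 1 else 0"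
    have "(\<Sum>a\<in>I. \<Sum>b\<in>I. ?c a * ?c b * A a b) = (\<Sum>a\<in>{i,n}. \<Sum>b\<in>{i,n}. ?c a * ?c b * A a b)"
    proof -
      have "(\<Sum>b\<in>I. ?c a * ?c b * A a b) = (\<Sum>b\<in>{i,n}. ?c a * ?c b * A a b)" for a
        using I by (intro sum.mono_neutral_right) auto
      then show ?thesis
        using I by (simp only:) (intro sum.mono_neutral_right, auto)
    qed
    also have "\<dots> = s * s * A i i + 2 * s * A i n"
      using False zero sym[OF I(2,3)] by (simp add: algebra_simps)
    finally show ?thesis using psd[of ?c] by simp
  qed
  show ?thesis
  proof (rule ccontr)
    assume nz: "A i n \<noteq> 0"
    \<comment> \<open>At \<open>s = - (A i n / t)\<close> the form is
      \<open>(A i n / t)^2 * (A i i - 2 * t)\<close>, so any positive \<open>t\<close> above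
      \<open>A i i / 2\<close> gives a contradiction.\<close>
    define t where "t = \<bar>A i i\<bar> + 1"
    have t: "t > 0" "A i i < 2 * t" by (auto simp: t_def)
    have "(- (A i n / t)) * (- (A i n / t)) * A i i + 2 * (- (A i n / t)) * A i n
        = (A i n / t)\<^sup>2 * (A i i - 2 * t)"
      using t by (simp add: field_simps power2_eq_square)
    also have "\<dots> < 0"
      using t nz by (intro mult_pos_neg) auto
    finally show False using quad[of "- (A i n / t)"] by simp
  qed
qed (use zero in simp)

text \<open>Schur product theorem. Splitting off a pivot writes \<open>A\<close> as a positive multiple of
  \<open>v v\<^sup>T\<close> plus a positive semidefinite matrix (the Schur complement) supported off the
  pivot; the first summand turns \<open>A \<circ> B\<close> into a diagonal congruence of \<open>B\<close>.\<close>

lemma psd_matrix_schur_product: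
  fixes A B :: "'i \<Rightarrow> 'i \<Rightarrow> real"
  assumes "finite I"
    and "\<And>c. (\<Sum>i\<in>I. \<Sum>j\<in>I. c i * c j * A i j) \<ge> 0"
    and "\<And>i j. i \<in> I \<Longrightarrow> j \<in> I \<Longrightarrow> A i j = A j i"
    and "\<And>c. (\<Sum>i\<in>I. \<Sum>j\<in>I. c i * c j * B i j) \<ge> 0"
  shows "(\<Sum>i\<in>I. \<Sum>j\<in>I. c i * c j * (A i j * B i j)) \<ge> 0"
  using assms
proof (induction I arbitrary: A c rule: finite_induct)
  case (insert n I)
  note psdA = insert.prems(1) and symA = insert.prems(2) and psdB = insert.prems(3)
  have restrict: "(\<Sum>i\<in>insert n I. \<Sum>j\<in>insert n I. c i * c j * D i j) = (\<Sum>i\<in>I. \<Sum>j\<in>I. c i * c j * D i j)"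
    if "\<And>i. i \<in> insert n I \<Longrightarrow> c i * D i n = 0" "\<And>i. i \<in> insert n I \<Longrightarrow> c i * D n i = 0"
    for c and D :: "'i \<Rightarrow> 'i \<Rightarrow> real"
  proof -
    have "c i * c n * D i n = 0" "c n * c i * D n i = 0" if "i \<in> insert n I" for i
      using \<open>\<And>i. i \<in> insert n I \<Longrightarrow> c i * D i n = 0\<close>[OF that]
        \<open>\<And>i. i \<in> insert n I \<Longrightarrow> c i * D n i = 0\<close>[OF that] by auto
    then have "(\<Sum>j\<in>insert n I. c n * c j * D n j) = 0" "(\<Sum>i\<in>I. c i * c n * D i n) = 0"
      by (auto intro!: sum.neutral simp del: mult_eq_0_iff)
    then show ?thesis using insert.hyps by (simp add: sum.distrib)
  qed
  have B: "(\<Sum>i\<in>I. \<Sum>j\<in>I. c i * c j * B i j) \<ge> 0" for c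
  proof -
    let ?c = "\<lambda>i. if i = n then 0 else c i"
    have "(\<Sum>i\<in>insert n I. \<Sum>j\<in>insert n I. ?c i * ?c j * B i j) = (\<Sum>i\<in>I. \<Sum>j\<in>I. ?c i * ?c j * B i j)"
      using insert.hyps by simp
    also have "\<dots> = (\<Sum>i\<in>I. \<Sum>j\<in>I. c i * c j * B i j)"
      using insert.hyps by (intro sum.cong) auto
    finally show ?thesis using psdB[of ?c] by simp
  qed
  \<comment> \<open>Since \<open>inverse 0 = 0\<close>, nothing is subtracted for a vanishing pivot;
    the pivot column of \<open>A\<close> is then zero already.\<close>
  define r where "r = inverse (A n n)"
  define A' where "A' i j = A i j - r * A i n * A j n" for i j
  have quad: "(\<Sum>i\<in>J. \<Sum>j\<in>J. d i * d j * A' i j)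
      = (\<Sum>i\<in>J. \<Sum>j\<in>J. d i * d j * A i j) - r * ((\<Sum>i\<in>J. d i * A i n) * (\<Sum>j\<in>J. d j * A j n))"
    for d J
    by (simp add: A'_def sum_product sum_distrib_left right_diff_distrib sum_subtractf mult_ac)
  have hadamard: "(\<Sum>i\<in>J. \<Sum>j\<in>J. d i * d j * (A i j * B i j))
      = r * (\<Sum>i\<in>J. \<Sum>j\<in>J. (d i * A i n) * (d j * A j n) * B i j)
        + (\<Sum>i\<in>J. \<Sum>j\<in>J. d i * d j * (A' i j * B i j))" for d J
    by (simp add: A'_def sum_distrib_left right_diff_distrib left_diff_distrib sum_subtractf mult_ac)
  have "A n n \<ge> 0"
  proof -
    define e :: "'i \<Rightarrow> real" where "e i = (if i = n then 1 else 0)" for i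
    have "e n = 1" "\<And>i. i \<in> I \<Longrightarrow> e i = 0" using insert.hyps by (auto simp: e_def)
    then have "(\<Sum>i\<in>insert n I. \<Sum>j\<in>insert n I. e i * e j * A i j) = A n n"
      using insert.hyps by (simp cong: sum.cong)
    then show ?thesis using psdA[of e] by simp
  qed
  then have r: "r \<ge> 0" by (simp add: r_def)
  have zero: "A i n = 0" if "A n n = 0" "i \<in> insert n I" for i
    by (rule psd_matrix_zero_diag[OF psdA symA, where n = n]) (use that insert.hyps(1) in auto)
  have A'n: "A' i n = 0" "A' n i = 0" if "i \<in> insert n I" for i
  proof -
    have sym: "A n i = A i n" using that by (intro symA) auto
    show "A' i n = 0"
      using zero[OF _ that] by (cases "A n n = 0") (simp_all add: A'_def r_def)
    then show "A' n i = 0" using sym by (simp add: A'_def mult.commute)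
  qed
  have A'sym: "A' i j = A' j i" if "i \<in> I" "j \<in> I" for i j
    using that symA[of i j] by (simp add: A'_def)
  have A'psd: "(\<Sum>i\<in>I. \<Sum>j\<in>I. c i * c j * A' i j) \<ge> 0" for c
  proof -
    define s where "s = (\<Sum>i\<in>I. c i * A i n)"
    \<comment> \<open>The coefficient at \<open>n\<close> makes \<open>?c\<close> orthogonal to the
      pivot column of \<open>A\<close>, so the square subtracted in \<open>quad\<close> vanishes and
      the form of \<open>A'\<close> equals that of \<open>A\<close>. The form of \<open>A'\<close>
      does not see this coefficient, because row and column \<open>n\<close> of \<open>A'\<close>
      are zero.\<close>
    let ?c = "\<lambda>i. if i = n then - r * s else c i"
    have s: "(\<Sum>i\<in>insert n I. ?c i * A i n) = 0"
    proof -
      have "(\<Sum>i\<in>insert n I. ?c i * A i n) = - r * s * A n n + (\<Sum>i\<in>I. ?c i * A i n)"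
        using insert.hyps by simp
      also have "(\<Sum>i\<in>I. ?c i * A i n) = s"
        unfolding s_def using insert.hyps by (intro sum.cong) auto
      also have "- r * s * A n n + s = 0"
      proof (cases "A n n = 0")
        case True
        then have "s = 0" unfolding s_def using zero by (intro sum.neutral) auto
        then show ?thesis by simp
      qed (simp add: r_def)
      finally show ?thesis .
    qed
    have "(\<Sum>i\<in>insert n I. \<Sum>j\<in>insert n I. ?c i * ?c j * A' i j)
        = (\<Sum>i\<in>insert n I. \<Sum>j\<in>insert n I. ?c i * ?c j * A i j)
          - r * ((\<Sum>i\<in>insert n I. ?c i * A i n) * (\<Sum>j\<in>insert n I. ?c j * A j n))"
      by (rule quad)
    also have "\<dots> \<ge> 0" using psdA[of ?c] s by simp
    also have "(\<Sum>i\<in>insert n I. \<Sum>j\<in>insert n I. ?c i * ?c j * A' i j)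
        = (\<Sum>i\<in>I. \<Sum>j\<in>I. ?c i * ?c j * A' i j)"
      using A'n by (intro restrict) auto
    also have "\<dots> = (\<Sum>i\<in>I. \<Sum>j\<in>I. c i * c j * A' i j)"
      using insert.hyps by (intro sum.cong) auto
    finally show ?thesis .
  qed
  have "0 \<le> (\<Sum>i\<in>I. \<Sum>j\<in>I. c i * c j * (A' i j * B i j))"
    by (rule insert.IH[OF A'psd A'sym B])
  also have "\<dots> = (\<Sum>i\<in>insert n I. \<Sum>j\<in>insert n I. c i * c j * (A' i j * B i j))"
    using A'n by (intro restrict[symmetric]) auto
  finally have "0 \<le> r * (\<Sum>i\<in>insert n I. \<Sum>j\<in>insert n I. (c i * A i n) * (c j * A j n) * B i j)
      + (\<Sum>i\<in>insert n I. \<Sum>j\<in>insert n I. c i * c j * (A' i j * B i j))"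
    using r psdB[of "\<lambda>i. c i * A i n"] by (intro add_nonneg_nonneg mult_nonneg_nonneg)
  also have "\<dots> = (\<Sum>i\<in>insert n I. \<Sum>j\<in>insert n I. c i * c j * (A i j * B i j))"
    by (rule hadamard[symmetric])
  finally show ?case .
qed simp

lemma pos_def_kernel_on_mult:
  assumes "pos_def_kernel_on E \<kappa>" "pos_def_kernel_on E \<kappa>'"
  shows "pos_def_kernel_on E (\<lambda>x y. \<kappa> x y * \<kappa>' x y)"
proof (rule pos_def_kernel_onI)
  fix I :: "nat set" and e c assume I: "finite I" "e ` I \<subseteq> E"
  show "(\<Sum>i\<in>I. \<Sum>j\<in>I. c i * c j * (\<kappa> (e i) (e j) * \<kappa>' (e i) (e j))) \<ge> 0"
  proof (rule psd_matrix_schur_product)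
    show "\<kappa> (e i) (e j) = \<kappa> (e j) (e i)" if "i \<in> I" "j \<in> I" for i j
      using that I by (intro pos_def_kernel_on_sym[OF assms(1)]) auto
  qed (use I in \<open>auto intro!: pos_def_kernel_on_sum_nonneg[OF assms(1)] pos_def_kernel_on_sum_nonneg[OF assms(2)]\<close>)
qed (simp add: pos_def_kernel_on_sym[OF assms(1)] pos_def_kernel_on_sym[OF assms(2)])

section \<open>Recursion for the alignment kernel\<close>

lemma is_alignment_bounds:
  assumes "is_alignment x y (p, q)" "i < length p"
  shows "1 \<le> p ! i" "p ! i \<le> length x" "1 \<le> q ! i" "q ! i \<le> length y"
proof -
  have bound: "1 \<le> r ! i \<and> r ! i \<le> last r"
    if "sorted r" "set r \<subseteq> {1..}" "i < length r" for r :: "nat list"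
  proof -
    have "1 \<le> r ! i" using that(2) nth_mem[OF that(3)] by auto
    moreover have "r ! i \<le> r ! (length r - 1)" using that by (intro sorted_nth_mono) auto
    moreover have "r \<noteq> []" using that by auto
    ultimately show ?thesis using that by (auto simp: last_conv_nth)
  qed
  have "sorted p" "sorted q" "set p \<subseteq> {1..}" "set q \<subseteq> {1..}" "length q = length p"
    "last p = length x" "last q = length y"
    using assms(1) by (auto simp: is_alignment_def)
  then show "1 \<le> p ! i" "p ! i \<le> length x" "1 \<le> q ! i" "q ! i \<le> length y"
    using bound[of p] bound[of q] assms(2) by auto
qed

text \<open>Without its last pair, an alignment still aligns two prefixes, and their lengths are the
  entries it now ends with; hence the \<open>take\<close>.\<close>

lemma is_alignment_snoc:
  assumes "p \<noteq> []" "q \<noteq> []"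
  shows "is_alignment x y (p @ [i], q @ [j]) \<longleftrightarrow>
    i = length x \<and> j = length y \<and>
    last p \<le> i \<and> i \<le> last p + 1 \<and> last q \<le> j \<and> j \<le> last q + 1 \<and> last p + last q < i + j \<and>
    is_alignment (take (last p) x) (take (last q) y) (p, q)" (is "?L \<longleftrightarrow> ?R")
proof
  assume L: ?L
  then have len: "length p = length q" by (simp add: is_alignment_def)
  have st: "(p @ [i]) ! Suc l \<le> (p @ [i]) ! l + 1 \<and> (q @ [j]) ! Suc l \<le> (q @ [j]) ! l + 1 \<and>
      (int ((p @ [i]) ! Suc l) - int ((p @ [i]) ! l)) + (int ((q @ [j]) ! Suc l) - int ((q @ [j]) ! l)) \<ge> 1"
    if "Suc l < length (p @ [i])" for l
    using L that unfolding is_alignment_def prod.case by blast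
  \<comment> \<open>The step condition at index \<open>length p - 1\<close> is the one that joins
    the old last pair to the appended pair.\<close>
  have "Suc (length p - 1) = length p" using assms by simp
  then have fin: "i \<le> last p + 1" "j \<le> last q + 1" "last p + last q < i + j"
    using st[of "length p - 1"] len assms by (auto simp: nth_append last_conv_nth)
  have inner: "p ! Suc l \<le> p ! l + 1 \<and> q ! Suc l \<le> q ! l + 1 \<and>
      (int (p ! Suc l) - int (p ! l)) + (int (q ! Suc l) - int (q ! l)) \<ge> 1" if "Suc l < length p" for l
    using st[of l] that len by (auto simp: nth_append)
  have le: "last p \<le> i" "last q \<le> j"
    using L assms by (auto simp: is_alignment_def sorted_append)
  show ?R
    using L assms len fin inner le by (auto simp: is_alignment_def sorted_append)
next
  assume R: ?R
  then have len: "length p = length q" by (simp add: is_alignment_def)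
  have inner: "p ! Suc l \<le> p ! l + 1 \<and> q ! Suc l \<le> q ! l + 1 \<and>
      (int (p ! Suc l) - int (p ! l)) + (int (q ! Suc l) - int (q ! l)) \<ge> 1" if "Suc l < length p" for l
    using R that by (simp add: is_alignment_def)
  have st: "(p @ [i]) ! Suc l \<le> (p @ [i]) ! l + 1 \<and> (q @ [j]) ! Suc l \<le> (q @ [j]) ! l + 1 \<and>
      (int ((p @ [i]) ! Suc l) - int ((p @ [i]) ! l)) + (int ((q @ [j]) ! Suc l) - int ((q @ [j]) ! l)) \<ge> 1"
    if "Suc l < Suc (length p)" for l
  proof (cases "Suc l = length p")
    case True
    then have "l = length p - 1" "l < length p" by auto
    then have "last p = p ! l" "last q = q ! l" using len assms by (auto simp: last_conv_nth)
    then show ?thesis using True R len by (auto simp: nth_append)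
  next
    case False
    then show ?thesis using inner[of l] that len by (auto simp: nth_append)
  qed
  have le: "a \<le> last r" if "sorted r" "a \<in> set r" for a and r :: "nat list"
    using that by (cases r rule: rev_cases) (auto simp: sorted_append)
  have srt: "sorted (p @ [i])" "sorted (q @ [j])"
    using R le[of p] le[of q] by (force simp: is_alignment_def sorted_append)+
  have "last p \<in> set p" "last q \<in> set q" "set p \<subseteq> {1..}" "set q \<subseteq> {1..}"
    using assms R by (auto simp: is_alignment_def)
  then have "1 \<le> i" "1 \<le> j" using R by fastforce+
  then show ?L
    using R assms len st srt by (auto simp: is_alignment_def)
qed

definition snoc_pair :: "'b \<Rightarrow> 'c \<Rightarrow> 'b list \<times> 'c list \<Rightarrow> 'b list \<times> 'c list" where
  "snoc_pair a b = (\<lambda>(p, q). (p @ [a], q @ [b]))"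

definition alignment_weight :: "('a \<Rightarrow> 'a \<Rightarrow> real) \<Rightarrow> 'a list \<Rightarrow> 'a list \<Rightarrow> nat list \<times> nat list \<Rightarrow> real" where
  "alignment_weight k x y = (\<lambda>(p, q). \<Prod>i<length p. k (x ! (p ! i - 1)) (y ! (q ! i - 1)))"

text \<open>The empty alignment of two empty sequences (excluded by \<^const>\<open>alignments\<close>) is the
  starting point of the recursion.\<close>

definition alignments0 :: "'a list \<Rightarrow> 'a list \<Rightarrow> (nat list \<times> nat list) set" where
  "alignments0 x y = (if x = [] \<and> y = [] then {([], [])} else alignments x y)"

definition alignment_kernel0 :: "('a \<Rightarrow> 'a \<Rightarrow> real) \<Rightarrow> 'a list \<Rightarrow> 'a list \<Rightarrow> real" where
  "alignment_kernel0 k x y = (\<Sum>\<pi>\<in>alignments0 x y. alignment_weight k x y \<pi>)"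

lemma alignment_kernel0_eq:
  "x \<noteq> [] \<Longrightarrow> alignment_kernel0 k x y = alignment_kernel k x y"
  by (simp add: alignment_kernel0_def alignments0_def alignment_kernel_def alignment_weight_def)

lemma finite_alignments0: "finite (alignments0 x y)"
  by (simp add: alignments0_def finite_alignments)

lemma alignments0_Nil:
  fixes x y :: "'b list"
  shows "alignments0 ([] :: 'b list) ([] :: 'b list) = {([], [])}"
    and "y \<noteq> [] \<Longrightarrow> alignments0 [] y = {}"
    and "x \<noteq> [] \<Longrightarrow> alignments0 x [] = {}"
proof -
  have "u \<noteq> [] \<and> v \<noteq> []" if "is_alignment u v (p, q)" for u v :: "'b list" and p q
  proof -
    have "p \<noteq> []" using that by (simp add: is_alignment_def)
    then show ?thesis using is_alignment_bounds[OF that, of 0] by auto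
  qed
  then show "alignments0 ([] :: 'b list) ([] :: 'b list) = {([], [])}"
    "y \<noteq> [] \<Longrightarrow> alignments0 [] y = {}" "x \<noteq> [] \<Longrightarrow> alignments0 x [] = {}"
    by (auto simp: alignments0_def alignments_def)
qed

lemma alignment_kernel0_Nil:
  "x = [] \<or> y = [] \<Longrightarrow> alignment_kernel0 k x y = (if x = [] \<and> y = [] then 1 else 0)"
  by (auto simp: alignment_kernel0_def alignments0_Nil alignment_weight_def)

lemma alignments0_bounds:
  assumes "(p, q) \<in> alignments0 x y"
  shows "length q = length p"
    and "i < length p \<Longrightarrow> 1 \<le> p ! i \<and> p ! i \<le> length x \<and> 1 \<le> q ! i \<and> q ! i \<le> length y"
  using assms is_alignment_bounds[of x y p q i]
  by (auto simp: alignments0_def alignments_def is_alignment_def split: if_splits)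

text \<open>The lengths of both sequences can be read off an alignment. Hence the three sets in the
  recursion are disjoint.\<close>

lemma alignments0_last:
  assumes "(p, q) \<in> alignments0 x y"
  shows "length x = (if p = [] then 0 else last p)" "length y = (if q = [] then 0 else last q)"
  using assms by (auto simp: alignments0_def alignments_def is_alignment_def split: if_splits)

text \<open>The last pair is forced to be \<open>(length x, length y)\<close>, and the admissible
  steps leave three predecessors: one index back in the first, in the second, or in both
  coordinates.\<close>

lemma alignments0_rec:
  assumes "x \<noteq> []" "y \<noteq> []"
  shows "alignments0 x y = snoc_pair (length x) (length y) `
    (alignments0 (butlast x) y \<union> alignments0 x (butlast y) \<union> alignments0 (butlast x) (butlast y))"
    (is "_ = ?f ` ?S")
proof (intro set_eqI iffI)
  fix \<pi> assume "\<pi> \<in> alignments0 x y"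
  then obtain p q where \<pi>: "\<pi> = (p, q)" and al: "is_alignment x y (p, q)"
    using assms by (cases \<pi>) (auto simp: alignments0_def alignments_def)
  have ne: "p \<noteq> []" "q \<noteq> []" using al by (auto simp: is_alignment_def)
  then obtain p' i q' j where pq: "p = p' @ [i]" "q = q' @ [j]"
    by (metis append_butlast_last_id)
  have len: "length p' = length q'" "i = length x" "j = length y"
    using al pq by (auto simp: is_alignment_def)
  have "(p', q') \<in> ?S"
  proof (cases "p' = []")
    case True
    \<comment> \<open>A single pair aligns two sequences of length one; it extends the empty
      alignment supplied by the diagonal predecessor.\<close>
    then have "length x = 1" "length y = 1" using al pq len by (auto simp: is_alignment_def)
    then have "butlast x = []" "butlast y = []" by (simp_all flip: length_0_conv)
    then show ?thesis using True len by (simp add: alignments0_Nil)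
  next
    case False
    then have ne': "p' \<noteq> []" "q' \<noteq> []" using len by auto
    have R: "last p' \<le> length x" "length x \<le> last p' + 1" "last q' \<le> length y"
      "length y \<le> last q' + 1" "last p' + last q' < length x + length y"
      "is_alignment (take (last p') x) (take (last q') y) (p', q')"
      using al[unfolded pq is_alignment_snoc[OF ne']] len by auto
    have "set p' \<subseteq> {1..}" using R(6) by (simp add: is_alignment_def)
    then have "last p' \<noteq> 0" using last_in_set[OF ne'(1)] by auto
    then have rest: "(p', q') \<in> alignments0 (take (last p') x) (take (last q') y)"
      using R(6) assms by (auto simp: alignments0_def alignments_def)
    consider "last p' = length x" "last q' = length y - 1"
      | "last p' = length x - 1" "last q' = length y"
      | "last p' = length x - 1" "last q' = length y - 1"
      using R by linarith
    then show ?thesis using rest by cases (auto simp: butlast_conv_take)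
  qed
  then show "\<pi> \<in> ?f ` ?S" using \<pi> pq len by (force simp: snoc_pair_def)
next
  fix \<pi> assume "\<pi> \<in> ?f ` ?S"
  then obtain p q where \<pi>: "\<pi> = (p @ [length x], q @ [length y])" and S: "(p, q) \<in> ?S"
    by (auto simp: snoc_pair_def)
  have pos: "0 < length x" "0 < length y" using assms by auto
  have len: "length q = length p" using S by (auto dest: alignments0_bounds(1))
  have "is_alignment x y \<pi>"
  proof (cases "p = []")
    case True
    then have "q = []" using len by simp
    \<comment> \<open>The empty pair belongs only to two empty sequences. As \<open>x\<close> and
      \<open>y\<close> are nonempty, it must come from the diagonal set.\<close>
    have "length (butlast x) = 0" "length (butlast y) = 0"
      using S True \<open>q = []\<close> alignments0_last[of p q] pos by force+
    then have "length x = 1" "length y = 1" using pos by (simp_all only: length_butlast)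
    then show ?thesis using True \<open>q = []\<close> \<pi> by (simp add: is_alignment_def)
  next
    case False
    then have ne: "p \<noteq> []" "q \<noteq> []" using len by auto
    \<comment> \<open>Since \<open>butlast\<close> is a prefix of length one less, one statement
      about prefixes of lengths \<open>a\<close> and \<open>b\<close> covers all three sets.\<close>
    have "is_alignment (take (last p) x) (take (last q) y) (p, q)"
      if "(p, q) \<in> alignments0 (take a x) (take b y)" "a \<le> length x" "b \<le> length y" for a b
      using that alignments0_last[OF that(1)] ne
      by (auto simp: alignments0_def alignments_def min_def split: if_splits)
    from this[of "length x - 1" "length y"] this[of "length x" "length y - 1"]
      this[of "length x - 1" "length y - 1"]
    have "is_alignment (take (last p) x) (take (last q) y) (p, q)"
      using S by (auto simp: butlast_conv_take)
    moreover have d: "(last p = length x - 1 \<and> last q = length y) \<or> (last p = length x \<and> last q = length y - 1)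
      \<or> (last p = length x - 1 \<and> last q = length y - 1)"
      using S alignments0_last[of p q] ne by force
    moreover have "last p \<le> length x" "length x \<le> last p + 1" "last q \<le> length y"
      "length y \<le> last q + 1" "last p + last q < length x + length y"
      using d pos by linarith+
    ultimately show ?thesis
      unfolding \<pi> is_alignment_snoc[OF ne] by blast
  qed
  then show "\<pi> \<in> alignments0 x y" using assms by (simp add: alignments0_def alignments_def)
qed

text \<open>The entries of \<open>p\<close> and \<open>q\<close> stay within \<open>x'\<close> and
  \<open>y'\<close>, so removing a last element does not change the values read there; the appended
  pair reads the two last elements.\<close>

lemma alignment_weight_snoc_pair:
  assumes "(p, q) \<in> alignments0 x' y'" "x \<noteq> []" "y \<noteq> []"
    and x': "x' = x \<or> x' = butlast x" and y': "y' = y \<or> y' = butlast y"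
  shows "alignment_weight k x y (snoc_pair (length x) (length y) (p, q))
    = k (last x) (last y) * alignment_weight k x' y' (p, q)"
proof -
  have len: "length q = length p" using alignments0_bounds(1)[OF assms(1)] .
  have nth: "x ! (p ! i - 1) = x' ! (p ! i - 1)" "y ! (q ! i - 1) = y' ! (q ! i - 1)"
    if "i < length p" for i
    using alignments0_bounds(2)[OF assms(1) that] x' y' by (auto simp: nth_butlast)
  have "alignment_weight k x y (snoc_pair (length x) (length y) (p, q))
      = (\<Prod>i<length p. k (x ! (p ! i - 1)) (y ! (q ! i - 1))) * k (last x) (last y)"
    using assms(2,3) len
    by (simp add: alignment_weight_def snoc_pair_def last_conv_nth nth_append)
  also have "(\<Prod>i<length p. k (x ! (p ! i - 1)) (y ! (q ! i - 1))) = alignment_weight k x' y' (p, q)"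
    using nth by (simp add: alignment_weight_def)
  finally show ?thesis by simp
qed

text \<open>Appending the final pair is injective and the three predecessor sets are disjoint, so
  the sum splits; the final pair contributes the common factor.\<close>

lemma alignment_kernel0_rec:
  assumes ne: "x \<noteq> []" "y \<noteq> []"
  shows "alignment_kernel0 k x y = k (last x) (last y) *
    (alignment_kernel0 k (butlast x) y + alignment_kernel0 k x (butlast y)
     + alignment_kernel0 k (butlast x) (butlast y))"
proof -
  let ?f = "snoc_pair (length x) (length y)"
  have disj: "alignments0 u v \<inter> alignments0 u' v' = {}"
    if "length u \<noteq> length u' \<or> length v \<noteq> length v'" for u u' v v' :: "'a list"
  proof -
    have False if "(p, q) \<in> alignments0 u v" "(p, q) \<in> alignments0 u' v'" for p q
      using alignments0_last[OF that(1)] alignments0_last[OF that(2)]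
        \<open>length u \<noteq> length u' \<or> length v \<noteq> length v'\<close> by simp
    then show ?thesis by auto
  qed
  have lt: "length x \<noteq> length x - 1" "length y \<noteq> length y - 1"
    using ne by (simp_all flip: length_greater_0_conv)
  have inj: "inj_on ?f A" for A by (auto simp: snoc_pair_def inj_on_def)
  have part: "(\<Sum>\<pi>\<in>alignments0 x' y'. alignment_weight k x y (?f \<pi>))
      = k (last x) (last y) * alignment_kernel0 k x' y'"
    if "x' = x \<or> x' = butlast x" "y' = y \<or> y' = butlast y" for x' y'
    unfolding alignment_kernel0_def sum_distrib_left
    using alignment_weight_snoc_pair[OF _ ne that] by (intro sum.cong) auto
  have "alignment_kernel0 k x y = (\<Sum>\<pi>\<in>alignments0 (butlast x) y \<union> alignments0 x (butlast y)
      \<union> alignments0 (butlast x) (butlast y). alignment_weight k x y (?f \<pi>))"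
    by (simp add: alignment_kernel0_def alignments0_rec[OF ne] sum.reindex[OF inj])
  also have "\<dots> = (\<Sum>\<pi>\<in>alignments0 (butlast x) y. alignment_weight k x y (?f \<pi>))
      + (\<Sum>\<pi>\<in>alignments0 x (butlast y). alignment_weight k x y (?f \<pi>))
      + (\<Sum>\<pi>\<in>alignments0 (butlast x) (butlast y). alignment_weight k x y (?f \<pi>))"
    using lt by (subst sum.union_disjoint; (simp add: finite_alignments0 Int_Un_distrib2 disj)?)+
  finally show ?thesis by (simp add: part distrib_left)
qed

section \<open>Approximation by positive definite kernels\<close>

text \<open>Contribution to the alignment kernel of at most \<open>n\<close> factors \<open>\<kappa> = k / (1 + k)\<close> after
  expanding every \<open>k\<close> as a geometric series in \<open>\<kappa>\<close>.\<close>

fun stretch_kernel :: "('a \<Rightarrow> 'a \<Rightarrow> real) \<Rightarrow> nat \<Rightarrow> 'a list \<Rightarrow> 'a list \<Rightarrow> real" where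
  "stretch_kernel \<kappa> 0 x y = (if x = [] \<and> y = [] then 1 else 0)"
| "stretch_kernel \<kappa> (Suc n) x y =
    (if x = [] \<or> y = [] then (if x = [] \<and> y = [] then 1 else 0)
     else \<kappa> (last x) (last y) *
       (stretch_kernel \<kappa> n x y + stretch_kernel \<kappa> n (butlast x) y
        + stretch_kernel \<kappa> n x (butlast y) + stretch_kernel \<kappa> n (butlast x) (butlast y)))"

lemma butlast_in_lists: "x \<in> lists X \<Longrightarrow> butlast x \<in> lists X"
  by (auto dest: in_set_butlastD)

text \<open>The recursion splits into blocks: a rank-one kernel on pairs of empty lists, zero on
  mixed pairs, and on nonempty lists a Schur product of \<open>\<kappa>\<close> at the last entries
  with a sum over shortened arguments.\<close>

lemma pos_def_stretch_kernel:
  assumes pd: "pos_def_kernel_on X \<kappa>"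
  shows "pos_def_kernel_on (lists X) (stretch_kernel \<kappa> n)"
proof (induction n)
  case 0
  show ?case
    by (rule pos_def_kernel_on_cong[OF pos_def_kernel_on_rank_one[where f = "\<lambda>x. if x = [] then 1 else 0"]])
      simp
next
  case (Suc n)
  \<comment> \<open>Summing over two booleans, each choosing between a list and its
    \<open>butlast\<close>, yields the four terms of the recursion.\<close>
  define f where "f b x = (if b then x else butlast x)" for b and x :: "'a list"
  let ?T = "\<lambda>x y. \<Sum>a\<in>UNIV. \<Sum>b\<in>UNIV. stretch_kernel \<kappa> n (f a x) (f b y)"
  have T: "pos_def_kernel_on (lists X \<inter> {x. x \<noteq> []}) ?T"
    by (rule pos_def_kernel_on_sum_maps[OF Suc.IH]) (auto simp: f_def dest: in_set_butlastD)
  \<comment> \<open>Nonemptiness guarantees that \<open>last\<close> lands in \<open>X\<close>;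
    \<open>last []\<close> is unspecified.\<close>
  have "pos_def_kernel_on (lists X \<inter> {x. x \<noteq> []}) (\<lambda>x y. \<kappa> (last x) (last y))"
    by (rule pos_def_kernel_on_comp[OF pd]) auto
  from pos_def_kernel_on_extend_zero[OF pos_def_kernel_on_mult[OF this T]]
  have "pos_def_kernel_on (lists X)
      (\<lambda>x y. (if x = [] then 1 else 0) * (if y = [] then 1 else 0) +
        (if x \<in> {x. x \<noteq> []} \<and> y \<in> {x. x \<noteq> []} then \<kappa> (last x) (last y) * ?T x y else 0))"
    by (intro pos_def_kernel_on_add pos_def_kernel_on_rank_one)
  then show ?case
    by (rule pos_def_kernel_on_cong) (auto simp: UNIV_bool f_def algebra_simps)
qed

section \<open>Monotone convergence to the alignment kernel\<close>

context
  fixes X :: "'a set" and k :: "'a \<Rightarrow> 'a \<Rightarrow> real" and \<kappa> :: "'a \<Rightarrow> 'a \<Rightarrow> real"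
  assumes k_pos: "\<And>x y. x \<in> X \<Longrightarrow> y \<in> X \<Longrightarrow> k x y > 0"
  defines "\<kappa> \<equiv> \<lambda>x y. k x y / (1 + k x y)"
begin

lemma kappa_bounds: "a \<in> X \<Longrightarrow> b \<in> X \<Longrightarrow> 0 < \<kappa> a b \<and> \<kappa> a b < 1"
  using k_pos[of a b] by (simp add: \<kappa>_def)

lemma last_kappa_bounds:
  assumes "x \<in> lists X" "y \<in> lists X" "x \<noteq> []" "y \<noteq> []"
  shows "0 < \<kappa> (last x) (last y) \<and> \<kappa> (last x) (last y) < 1"
  using assms last_in_set[of x] last_in_set[of y] by (intro kappa_bounds) auto

text \<open>The equation \<open>M = k S\<close> is equivalent to \<open>M = \<kappa> (M + S)\<close>.\<close>

lemma alignment_kernel0_fixpoint: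
  assumes "x \<in> lists X" "y \<in> lists X" "x \<noteq> []" "y \<noteq> []"
  shows "alignment_kernel0 k x y = \<kappa> (last x) (last y) *
    (alignment_kernel0 k x y + alignment_kernel0 k (butlast x) y
     + alignment_kernel0 k x (butlast y) + alignment_kernel0 k (butlast x) (butlast y))"
proof -
  have "k (last x) (last y) > 0"
    using assms last_in_set[of x] last_in_set[of y] by (intro k_pos) auto
  then have "1 + k (last x) (last y) \<noteq> 0" by simp
  then show ?thesis
    using alignment_kernel0_rec[OF assms(3,4), of k] by (simp add: \<kappa>_def field_simps)
qed

lemma stretch_kernel_nonneg:
  assumes "x \<in> lists X" "y \<in> lists X" shows "stretch_kernel \<kappa> n x y \<ge> 0"
  using assms
proof (induction n arbitrary: x y)
  case (Suc n)
  then show ?case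
    using last_kappa_bounds[of x y] butlast_in_lists[of x X] butlast_in_lists[of y X]
    by (auto simp del: in_lists_conv_set intro!: mult_nonneg_nonneg add_nonneg_nonneg)
qed simp

text \<open>The recursion has nonnegative coefficients, so an inequality between consecutive stages
  propagates. It holds initially because stage 0 is zero except at the empty pair, where every stage
  is 1.\<close>

lemma stretch_kernel_mono_Suc:
  assumes "x \<in> lists X" "y \<in> lists X"
  shows "stretch_kernel \<kappa> n x y \<le> stretch_kernel \<kappa> (Suc n) x y"
  using assms
proof (induction n arbitrary: x y)
  case 0
  then show ?case using stretch_kernel_nonneg[of x y 1] by auto
next
  case (Suc n)
  show ?case
  proof (cases "x = [] \<or> y = []")
    case False
    let ?S = "\<lambda>n. stretch_kernel \<kappa> n x y + stretch_kernel \<kappa> n (butlast x) y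
        + stretch_kernel \<kappa> n x (butlast y) + stretch_kernel \<kappa> n (butlast x) (butlast y)"
    have eq: "stretch_kernel \<kappa> (Suc m) x y = \<kappa> (last x) (last y) * ?S m" for m
      using False by simp
    have "?S n \<le> ?S (Suc n)"
      by (intro add_mono Suc.IH Suc.prems butlast_in_lists)
    then have "\<kappa> (last x) (last y) * ?S n \<le> \<kappa> (last x) (last y) * ?S (Suc n)"
      using last_kappa_bounds[OF Suc.prems] False by (intro mult_left_mono) auto
    then show ?thesis by (simp only: eq[of n, symmetric] eq[of "Suc n", symmetric])
  qed auto
qed

lemma alignment_kernel0_nonneg:
  assumes "x \<in> lists X" "y \<in> lists X"
  shows "alignment_kernel0 k x y \<ge> 0"
  unfolding alignment_kernel0_def
proof (intro sum_nonneg, clarify)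
  fix p q assume "(p, q) \<in> alignments0 x y"
  from alignments0_bounds(2)[OF this] assms
  show "0 \<le> alignment_weight k x y (p, q)"
    unfolding alignment_weight_def prod.case
    by (intro prod_nonneg ballI less_imp_le k_pos) (fastforce simp: subset_iff)+
qed

text \<open>The alignment kernel is a fixed point of the monotone recursion that produces the
  stages, and it dominates stage 0.\<close>

lemma stretch_kernel_le:
  assumes "x \<in> lists X" "y \<in> lists X"
  shows "stretch_kernel \<kappa> n x y \<le> alignment_kernel0 k x y"
  using assms
proof (induction n arbitrary: x y)
  case 0
  then show ?case using alignment_kernel0_nonneg[of x y] by (auto simp: alignment_kernel0_Nil)
next
  case (Suc n)
  show ?case
  proof (cases "x = [] \<or> y = []")
    case False
    then show ?thesis
      unfolding stretch_kernel.simps(2)[of \<kappa> n x y]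
      using Suc last_kappa_bounds[of x y] butlast_in_lists[of x X] butlast_in_lists[of y X]
      by (subst alignment_kernel0_fixpoint)
        (auto simp del: in_lists_conv_set stretch_kernel.simps intro!: mult_left_mono add_mono)
  qed (auto simp: alignment_kernel0_Nil)
qed

text \<open>Monotonicity and the upper bound give some limit \<open>L\<close>. Passing to the limit
  in the recursion, with the three shorter pairs known by induction on the total length, identifies
  it.\<close>

lemma stretch_kernel_tendsto:
  assumes "x \<in> lists X" "y \<in> lists X"
  shows "(\<lambda>n. stretch_kernel \<kappa> n x y) \<longlonglongrightarrow> alignment_kernel0 k x y"
  using assms
proof (induction "length x + length y" arbitrary: x y rule: less_induct)
  case less
  show ?case
  proof (cases "x = [] \<or> y = []")
    case True
    then have "stretch_kernel \<kappa> n x y = alignment_kernel0 k x y" for n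
      by (cases n) (auto simp: alignment_kernel0_Nil)
    then show ?thesis by simp
  next
    case False
    let ?x = "butlast x" and ?y = "butlast y" and ?q = "\<kappa> (last x) (last y)"
    have IH: "(\<lambda>n. stretch_kernel \<kappa> n ?x y) \<longlonglongrightarrow> alignment_kernel0 k ?x y"
      "(\<lambda>n. stretch_kernel \<kappa> n x ?y) \<longlonglongrightarrow> alignment_kernel0 k x ?y"
      "(\<lambda>n. stretch_kernel \<kappa> n ?x ?y) \<longlonglongrightarrow> alignment_kernel0 k ?x ?y"
      using less False butlast_in_lists[of x X] butlast_in_lists[of y X]
      by (simp_all del: in_lists_conv_set flip: length_greater_0_conv)
    have "incseq (\<lambda>n. stretch_kernel \<kappa> n x y)"
      by (rule incseq_SucI) (rule stretch_kernel_mono_Suc[OF less.prems])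
    then obtain L where L: "(\<lambda>n. stretch_kernel \<kappa> n x y) \<longlonglongrightarrow> L"
      by (rule incseq_convergent) (use stretch_kernel_le[OF less.prems] in blast)
    have "(\<lambda>n. stretch_kernel \<kappa> (Suc n) x y) \<longlonglongrightarrow>
        ?q * (L + alignment_kernel0 k ?x y + alignment_kernel0 k x ?y + alignment_kernel0 k ?x ?y)"
      using False by (auto intro!: tendsto_intros L IH)
    then have "L = ?q * (L + alignment_kernel0 k ?x y + alignment_kernel0 k x ?y + alignment_kernel0 k ?x ?y)"
      using LIMSEQ_Suc[OF L] LIMSEQ_unique by blast
    moreover have "alignment_kernel0 k x y = ?q * (alignment_kernel0 k x y
        + alignment_kernel0 k ?x y + alignment_kernel0 k x ?y + alignment_kernel0 k ?x ?y)"
      using False by (intro alignment_kernel0_fixpoint less.prems) auto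
    \<comment> \<open>\<open>L\<close> and the alignment kernel solve the same affine equation,
      whose slope \<open>?q\<close> is below 1, so the solution is unique.\<close>
    ultimately have "(L - alignment_kernel0 k x y) * (1 - ?q) = 0"
      by (simp add: algebra_simps)
    then have "L = alignment_kernel0 k x y"
      using last_kappa_bounds[OF less.prems] False by auto
    then show ?thesis using L by simp
  qed
qed

end

theorem theorem1:
  fixes X :: "'a set" and k :: "'a \<Rightarrow> 'a \<Rightarrow> real"
  assumes "\<And>x y. x \<in> X \<Longrightarrow> y \<in> X \<Longrightarrow> k x y > 0"
    and "pos_def_kernel_on X k"
    and "pos_def_kernel_on X (\<lambda>x y. k x y / (1 + k x y))"
  shows "pos_def_kernel_on (nonempty_seqs X) (alignment_kernel k)"
proof -
  \<comment> \<open>The limit is taken on all lists because the recursion descends to the empty one;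
    on nonempty sequences the extended kernel is the alignment kernel.\<close>
  have "pos_def_kernel_on (lists X) (alignment_kernel0 k)"
    by (rule pos_def_kernel_on_limit[OF pos_def_stretch_kernel[OF assms(3)] stretch_kernel_tendsto[OF assms(1)]])
  then have "pos_def_kernel_on (nonempty_seqs X) (alignment_kernel0 k)"
    by (rule pos_def_kernel_on_subset) (auto simp: nonempty_seqs_def)
  then show ?thesis
    by (rule pos_def_kernel_on_cong) (simp add: alignment_kernel0_eq nonempty_seqs_def)
qed

end
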